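(* Let $F:\mathbb{R}^m\to\mathbb{R}^m$ be continuously differentiable and Lipschitz continuous with a constant $L$. Assume that $\mathrm{Sol}(\mathbb{R}^m,F)\neq\emptyset$ and that there is $\zeta>0$ such that $$\zeta\,\mathrm{dist}(x,\mathrm{Sol}(\mathbb{R}^m,F))\le\|F(x)\|\qquad\text{for all }x\in\mathbb{R}^m.$$ Consider the dynamical system $\dot x=-\nabla F(x)^\top F(x)$. Assume that there is $\eta>0$ such that, for every $x$ with $F(x)\neq 0$, either $$\lambda_{\min}(\nabla F(x)\nabla F(x)^\top)\ge\eta,$$ or $$\lambda_{\min}(\nabla F(x)\nabla F(x)^\top)=0,\qquad \lambda_2(\nabla F(x)\nabla F(x)^\top)\ge\eta,$$ and $F(x)$ is orthogonal to the eigenspace of $\nabla F(x)\nabla F(x)^\top$ corresponding to the eigenvalue $0$. Then the set $\mathrm{Sol}(\mathbb{R}^m,F)$ is exponentially stable for the system $\dot x=-\nabla F(x)^\top F(x)$.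
   Context: For $K\subseteq\mathbb{R}^m$ and $F:K\to\mathbb{R}^m$, $\mathrm{Sol}(K,F)=\{x^*\in K\mid \langle F(x^* ),x-x^*\rangle\ge 0\ \text{for all }x\in K\}$. $\nabla F(x)$ is the Jacobian matrix of $F$ at $x$. For a symmetric matrix $A$, $\lambda_{\min}(A)$ is its smallest eigenvalue and $\lambda_2(A)$ its second smallest eigenvalue. $\|\cdot\|$ is the Euclidean norm and $\mathrm{dist}(x,M)=\inf_{y\in M}\|x-y\|$. For a system $\dot x=f(x)$ with domain $\mathrm{dom}(f)\subseteq\mathbb{R}^m$: a set $M$ is positively invariant if $x(0)\in M$ implies $x(t)\in M$ for all $t\ge0$. A closed positively invariant set $M$ is exponentially stable if there are constants $\beta_1,\beta_2,\beta_3>0$ such that for all $x(0)\in\mathrm{dom}(f)$ with $\mathrm{dist}(x(0),M)\le\beta_3$ one has $\mathrm{dist}(x(t),M)\le\beta_1\,\mathrm{dist}(x(0),M)e^{-\beta_2 t}$ for all $t\ge0$. Standing assumption: the vector field $f$ is continuous and the system has a unique solution $x:[0,+\infty)\to\mathbb{R}^m$ for every initial point in $\mathrm{dom}(f)$. *)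

theory Defs
  imports "HOL-Analysis.Analysis"
begin

definition Sol :: "'a::real_inner set \<Rightarrow> ('a \<Rightarrow> 'a) \<Rightarrow> 'a set" where
  "Sol K F = {xs \<in> K. \<forall>x\<in>K. F xs \<bullet> (x - xs) \<ge> 0}"

definition continuously_differentiable :: "(real^'n \<Rightarrow> real^'m) \<Rightarrow> bool" where
  "continuously_differentiable F \<longleftrightarrow>
     (\<forall>x. F differentiable (at x)) \<and> continuous_on UNIV (\<lambda>x. jacobian F (at x))"

definition eigenspace :: "real^'n^'n \<Rightarrow> real \<Rightarrow> (real^'n) set" where
  "eigenspace A c = {v. A *v v = c *\<^sub>R v}"

definition eigenvalues :: "real^'n^'n \<Rightarrow> real set" where
  "eigenvalues A = {c. \<exists>v. v \<noteq> 0 \<and> A *v v = c *\<^sub>R v}"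

text \<open>The next two definitions are meant for symmetric matrices, which have a finite nonempty
  set of eigenvalues, all of them real.\<close>

definition lambda_min :: "real^'n^'n \<Rightarrow> real" where
  "lambda_min A = Min (eigenvalues A)"

text \<open>Eigenvalues are taken as a set, so \<open>lambda_2\<close> is the second smallest number that occurs as an
  eigenvalue. If \<open>\<lambda>\<^sub>1 \<le> \<lambda>\<^sub>2 \<le> \<dots>\<close> lists the eigenvalues with multiplicity and \<open>\<lambda>\<^sub>1 < \<lambda>\<^sub>2\<close>, then
  \<open>lambda_2 A = \<lambda>\<^sub>2\<close>; so a condition \<open>\<lambda>\<^sub>1 = 0\<close>, \<open>\<lambda>\<^sub>2 \<ge> \<eta> > 0\<close> that counts multiplicities implies the one
  expressed with \<open>lambda_2\<close>. The value is unspecified if \<open>A\<close> has only one eigenvalue; for symmetric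
  \<open>A\<close> with \<open>lambda_min A = 0\<close> this means \<open>A = 0\<close>, and then only the zero vector is orthogonal to
  \<open>eigenspace A 0\<close>.\<close>

definition lambda_2 :: "real^'n^'n \<Rightarrow> real" where
  "lambda_2 A = Min (eigenvalues A - {lambda_min A})"

text \<open>A trajectory is a total function on the reals of which only the values at \<open>t \<ge> 0\<close> matter;
  at \<open>t = 0\<close> the derivative is one-sided. Uniqueness is therefore uniqueness on \<open>{0..}\<close>.\<close>

definition solution :: "('a::real_normed_vector \<Rightarrow> 'a) \<Rightarrow> 'a set \<Rightarrow> (real \<Rightarrow> 'a) \<Rightarrow> bool" where
  "solution f D x \<longleftrightarrow>
     (\<forall>t\<ge>0. x t \<in> D \<and> (x has_vector_derivative f (x t)) (at t within {0..}))"

definition dynamical_system :: "('a::real_normed_vector \<Rightarrow> 'a) \<Rightarrow> 'a set \<Rightarrow> bool" where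
  "dynamical_system f D \<longleftrightarrow> continuous_on D f \<and>
     (\<forall>x0\<in>D. \<exists>x. solution f D x \<and> x 0 = x0 \<and>
        (\<forall>y. solution f D y \<and> y 0 = x0 \<longrightarrow> (\<forall>t\<ge>0. y t = x t)))"

definition positively_invariant ::
  "('a::real_normed_vector \<Rightarrow> 'a) \<Rightarrow> 'a set \<Rightarrow> 'a set \<Rightarrow> bool" where
  "positively_invariant f D M \<longleftrightarrow>
     (\<forall>x. solution f D x \<and> x 0 \<in> M \<longrightarrow> (\<forall>t\<ge>0. x t \<in> M))"

definition exponentially_stable ::
  "('a::real_normed_vector \<Rightarrow> 'a) \<Rightarrow> 'a set \<Rightarrow> 'a set \<Rightarrow> bool" where
  "exponentially_stable f D M \<longleftrightarrow> closed M \<and> positively_invariant f D M \<and>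
     (\<exists>\<beta>1>0. \<exists>\<beta>2>0. \<exists>\<beta>3>0. \<forall>x. solution f D x \<and> infdist (x 0) M \<le> \<beta>3 \<longrightarrow>
        (\<forall>t\<ge>0. infdist (x t) M \<le> \<beta>1 * infdist (x 0) M * exp (- \<beta>2 * t)))"

end

theory Submission
  imports Defs
begin

text \<open>Here \<open>Sol UNIV F\<close> is the zero set of \<open>F\<close>. Along a trajectory,
  \<open>\<parallel>F\<parallel>\<^sup>2\<close> has derivative \<open>- 2 (F \<bullet> A F)\<close> with \<open>A = J J\<^sup>T\<close>, and the spectral hypothesis amounts to
  \<open>F \<bullet> A F \<ge> \<eta> \<parallel>F\<parallel>\<^sup>2\<close>, because the Rayleigh quotient of \<open>A\<close> on an invariant subspace attains its
  minimum at an eigenvector. Hence \<open>\<parallel>F\<parallel>\<close> decays like \<open>exp (- \<eta> t)\<close>; the error bound and the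
  Lipschitz constant convert this into decay of the distance to the zero set.\<close>

section \<open>Zeros of \<open>F\<close> and the distance to them\<close>

lemma Sol_UNIV: "Sol UNIV F = {x. F x = 0}"
proof -
  have "F x = 0" if "\<forall>y. F x \<bullet> (y - x) \<ge> 0" for x
  proof -
    \<comment> \<open>The test point \<open>x - F x\<close> turns the inequality into nonnegativity
      of minus the squared norm of \<open>F x\<close>.\<close>
    have "F x \<bullet> ((x - F x) - x) \<ge> 0" using that by blast
    then show ?thesis by (simp flip: power2_norm_eq_inner)
  qed
  then show ?thesis by (auto simp: Sol_def)
qed

lemma norm_le_lipschitz_infdist:
  fixes F :: "'a::metric_space \<Rightarrow> 'b::real_normed_vector"
  assumes "L-lipschitz_on UNIV F" and "Z \<noteq> {}" and "\<And>z. z \<in> Z \<Longrightarrow> F z = 0"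
  shows "norm (F x) \<le> L * infdist x Z"
\<comment> \<open>The infimum over \<open>Z\<close> is taken after division by \<open>L\<close>; for
  \<open>L = 0\<close> the map is constant, hence zero.\<close>
proof (cases "L = 0")
  case True
  obtain z where "z \<in> Z" using assms(2) by blast
  then show ?thesis
    using lipschitz_onD[OF assms(1), of x z] assms(3) True by (simp add: dist_norm)
next
  case False
  then have "L > 0" using lipschitz_on_nonneg[OF assms(1)] by simp
  have "norm (F x) / L \<le> dist x z" if "z \<in> Z" for z
    using lipschitz_onD[OF assms(1), of x z] assms(3)[OF that] \<open>L > 0\<close>
    by (simp add: dist_norm field_simps)
  then have "norm (F x) / L \<le> infdist x Z"
    using assms(2) by (simp add: infdist_def cINF_greatest)
  then show ?thesis using \<open>L > 0\<close> by (simp add: field_simps)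
qed

section \<open>Spectra of symmetric matrices\<close>

lemma inner_symmetric_matrix:
  fixes A :: "real^'n^'n"
  assumes "transpose A = A"
  shows "x \<bullet> (A *v y) = (A *v x) \<bullet> y"
  using dot_lmul_matrix[of x A y] transpose_matrix_vector[of A x] assms by simp

text \<open>Eigenvectors chosen for distinct eigenvalues are orthogonal, hence independent, and
  independent sets are finite here. This lets \<open>Min\<close> in \<open>lambda_min\<close> and
  \<open>lambda_2\<close> be compared with any single eigenvalue.\<close>

lemma finite_eigenvalues:
  fixes A :: "real^'n^'n"
  assumes sym: "transpose A = A"
  shows "finite (eigenvalues A)"
proof -
  obtain e where e: "\<And>c. c \<in> eigenvalues A \<Longrightarrow> e c \<noteq> 0 \<and> A *v e c = c *\<^sub>R e c"
    using that bchoice[of "eigenvalues A" "\<lambda>c v. v \<noteq> 0 \<and> A *v v = c *\<^sub>R v"]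
    by (auto simp: eigenvalues_def)
  have orth: "e c \<bullet> e d = 0" if "c \<in> eigenvalues A" "d \<in> eigenvalues A" "c \<noteq> d" for c d
  proof -
    have "d * (e c \<bullet> e d) = c * (e c \<bullet> e d)"
      using inner_symmetric_matrix[OF sym, of "e c" "e d"] e that by simp
    then show ?thesis using that(3) by simp
  qed
  have inj: "inj_on e (eigenvalues A)"
    by (rule inj_onI) (metis e inner_eq_zero_iff orth)
  have "independent (e ` eigenvalues A)"
    by (rule pairwise_orthogonal_independent)
      (use e orth in \<open>auto simp: pairwise_def orthogonal_def\<close>)
  then have "finite (e ` eigenvalues A)" by (rule independent_imp_finite)
  then show ?thesis using inj by (rule finite_imageD)
qed

text \<open>A minimizer \<open>v\<close> of the quadratic form on the compact unit sphere of
  \<open>S\<close> is an eigenvector: invariance of \<open>S\<close> makes the residual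
  \<open>A *v v - c *\<^sub>R v\<close> an admissible direction of variation.\<close>

lemma symmetric_minimal_eigenvector:
  fixes A :: "real^'n^'n"
  assumes sym: "transpose A = A" and S: "subspace S" "S \<noteq> {0}"
    and inv: "\<And>w. w \<in> S \<Longrightarrow> A *v w \<in> S"
  obtains v c where "v \<in> S" "v \<noteq> 0" "A *v v = c *\<^sub>R v"
    "\<And>w. w \<in> S \<Longrightarrow> w \<bullet> (A *v w) \<ge> c * (w \<bullet> w)"
proof -
  define K where "K = S \<inter> sphere 0 1"
  obtain s where s: "s \<in> S" "s \<noteq> 0" using S subspace_0 by blast
  have "compact K"
    unfolding K_def using closed_subspace[OF S(1)] by (simp add: closed_Int_compact)
  moreover have "(1 / norm s) *\<^sub>R s \<in> K"
    unfolding K_def using s subspace_scale[OF S(1) s(1)] by simp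
  then have "K \<noteq> {}" by blast
  moreover have "continuous_on K (\<lambda>w. w \<bullet> (A *v w))"
    by (intro continuous_intros matrix_vector_mult_linear_continuous_on)
  ultimately obtain v where v: "v \<in> K" and min: "\<And>w. w \<in> K \<Longrightarrow> v \<bullet> (A *v v) \<le> w \<bullet> (A *v w)"
    using continuous_attains_inf by metis
  define c where "c = v \<bullet> (A *v v)"
  define B where "B w = w \<bullet> (A *v w) - c * (w \<bullet> w)" for w
  have vS: "v \<in> S" and vv: "v \<bullet> v = 1" using v by (auto simp: K_def norm_eq_1)
  have Bpos: "B w \<ge> 0" if "w \<in> S" for w
  proof (cases "w = 0")
    case False
    have "(1 / norm w) *\<^sub>R w \<in> K"
      unfolding K_def using False subspace_scale[OF S(1) that] by simp
    from min[OF this] have "c \<le> (w \<bullet> (A *v w)) / (w \<bullet> w)"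
      unfolding c_def
      by (simp add: matrix_vector_mult_scaleR dot_square_norm power2_eq_square)
    then show ?thesis using False by (simp add: B_def field_simps)
  qed (simp add: B_def)
  define u where "u = A *v v - c *\<^sub>R v"
  define p where "p = u \<bullet> u"
  have uS: "u \<in> S"
    unfolding u_def using S(1) vS inv by (simp add: subspace_diff subspace_scale)
  \<comment> \<open>\<open>B\<close> is minimal at \<open>v\<close>, so its first variation in the direction \<open>u\<close>, which is \<open>2 (u \<bullet> u)\<close>, vanishes.\<close>
  have expand: "B (v + t *\<^sub>R u) = 2 * t * p + t\<^sup>2 * B u" for t
  proof -
    have "v \<bullet> (A *v u) = u \<bullet> (A *v v)"
      using inner_symmetric_matrix[OF sym, of v u] by (simp add: inner_commute)
    moreover have "u \<bullet> (A *v v) = p + c * (u \<bullet> v)"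
      by (simp add: p_def u_def inner_diff_right inner_diff_left algebra_simps)
    ultimately show ?thesis
      using vv c_def
      by (simp add: B_def matrix_vector_right_distrib matrix_vector_mult_scaleR inner_add_left
          inner_add_right inner_commute[of v u] power2_eq_square algebra_simps)
  qed
  have "p = 0"
  proof (rule ccontr)
    assume "p \<noteq> 0"
    then have "p > 0" unfolding p_def by simp
    define b where "b = B u"
    have "b \<ge> 0" using Bpos[OF uS] by (simp add: b_def)
    \<comment> \<open>\<open>B (v - t u) = t (t b - 2 p)\<close> is negative once
      \<open>t b < p\<close>. The \<open>+ 1\<close> allows \<open>b = 0\<close> and gives
      \<open>t b = p - t\<close>.\<close>
    define t where "t = p / (b + 1)"
    have "t > 0" using \<open>p > 0\<close> \<open>b \<ge> 0\<close> by (simp add: t_def)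
    have "t * (b + 1) = p" using \<open>b \<ge> 0\<close> by (simp add: t_def)
    then have "t * b + t = p" by (simp add: distrib_left)
    have "0 \<le> B (v + (- t) *\<^sub>R u)"
      using Bpos S(1) vS uS by (meson subspace_add subspace_scale)
    also have "\<dots> = t * (t * b - 2 * p)"
      unfolding expand b_def by (simp add: power2_eq_square algebra_simps)
    also have "\<dots> < 0"
      by (rule mult_pos_neg) (use \<open>t > 0\<close> \<open>p > 0\<close> \<open>t * b + t = p\<close> in linarith)+
    finally show False by simp
  qed
  then have "A *v v = c *\<^sub>R v" by (simp add: p_def u_def)
  moreover have "v \<noteq> 0" using vv by auto
  ultimately show ?thesis using that[of v c] vS Bpos unfolding B_def by force
qed

lemma Rayleigh_lambda_min:
  fixes A :: "real^'n^'n"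
  assumes sym: "transpose A = A" and "lambda_min A \<ge> \<eta>"
  shows "w \<bullet> (A *v w) \<ge> \<eta> * (w \<bullet> w)"
proof -
  \<comment> \<open>Index types are nonempty, so a coordinate vector is a nonzero element.\<close>
  have "(UNIV :: (real^'n) set) \<noteq> {0}"
    by (metis UNIV_I axis_eq_0_iff singletonD zero_neq_one)
  then obtain v c where v: "v \<noteq> 0" "A *v v = c *\<^sub>R v"
    and c: "\<And>w. w \<bullet> (A *v w) \<ge> c * (w \<bullet> w)"
    using symmetric_minimal_eigenvector[OF sym subspace_UNIV] by (metis UNIV_I)
  have "c \<in> eigenvalues A" using v by (auto simp: eigenvalues_def)
  then have "\<eta> \<le> c"
    using assms(2) Min_le[OF finite_eigenvalues[OF sym]] unfolding lambda_min_def by force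
  then show ?thesis using c[of w] mult_right_mono[of \<eta> c "w \<bullet> w"] by simp
qed

text \<open>On the orthogonal complement of the kernel the minimal eigenvalue is nonzero, since a
  kernel vector there would be orthogonal to itself. It therefore survives the removal of
  \<open>lambda_min A = 0\<close> and is at least \<open>lambda_2 A\<close>.\<close>

lemma Rayleigh_lambda_2:
  fixes A :: "real^'n^'n"
  assumes sym: "transpose A = A" and "lambda_min A = 0" and "lambda_2 A \<ge> \<eta>"
    and w: "\<forall>v\<in>eigenspace A 0. orthogonal w v"
  shows "w \<bullet> (A *v w) \<ge> \<eta> * (w \<bullet> w)"
proof (cases "w = 0")
  case False
  define S where "S = {x. \<forall>v\<in>eigenspace A 0. orthogonal x v}"
  have S: "subspace S"
    unfolding S_def by (auto simp: subspace_def orthogonal_def inner_add_left)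
  have wS: "w \<in> S" using w by (simp add: S_def)
  \<comment> \<open>By symmetry the range of \<open>A\<close> is orthogonal to its kernel.\<close>
  have inv: "A *v x \<in> S" for x
    unfolding S_def
    by (auto simp: orthogonal_def eigenspace_def inner_symmetric_matrix[OF sym, symmetric])
  obtain v c where v: "v \<in> S" "v \<noteq> 0" "A *v v = c *\<^sub>R v"
    and c: "\<And>w. w \<in> S \<Longrightarrow> w \<bullet> (A *v w) \<ge> c * (w \<bullet> w)"
    using symmetric_minimal_eigenvector[OF sym S _ inv] wS False by blast
  have "c \<noteq> 0"
    using v by (auto simp: S_def eigenspace_def orthogonal_def)
  then have "c \<in> eigenvalues A - {lambda_min A}"
    using v assms(2) by (auto simp: eigenvalues_def)
  then have "\<eta> \<le> c"
    using assms(3) Min_le[OF finite_Diff[OF finite_eigenvalues[OF sym]], of c "{lambda_min A}"]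
    unfolding lambda_2_def by linarith
  then show ?thesis using c[OF wS] mult_right_mono[of \<eta> c "w \<bullet> w"] by simp
qed simp

section \<open>Exponential decay along trajectories\<close>

lemma gradient_flow_norm_decay:
  fixes F :: "real^'m \<Rightarrow> real^'m"
  assumes diff: "\<And>x. F differentiable (at x)"
    and coercive: "\<And>x. \<eta> * (norm (F x))\<^sup>2 \<le> (norm (transpose (jacobian F (at x)) *v F x))\<^sup>2"
    and sol: "solution (\<lambda>x. - (transpose (jacobian F (at x)) *v F x)) UNIV x"
    and "t \<ge> 0"
  shows "norm (F (x t)) \<le> norm (F (x 0)) * exp (- \<eta> * t)"
proof -
  define J where "J s = jacobian F (at (x s))" for s
  \<comment> \<open>The exponential weight turns the differential inequality for the squared norm
    into monotonicity of \<open>g\<close>.\<close>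
  define g where "g s = (norm (F (x s)))\<^sup>2 * exp (2 * \<eta> * s)" for s
  define g' where "g' s = 2 * (\<eta> * (norm (F (x s)))\<^sup>2 - (norm (transpose (J s) *v F (x s)))\<^sup>2)
      * exp (2 * \<eta> * s)" for s
  have deriv: "(g has_real_derivative g' s) (at s within {0..})" if "s \<ge> 0" for s
  proof -
    let ?f = "- (transpose (J s) *v F (x s))"
    have x: "(x has_derivative (\<lambda>h. h *\<^sub>R ?f)) (at s within {0..})"
      using sol that unfolding solution_def has_vector_derivative_def J_def by blast
    have F: "(F has_derivative (*v) (J s)) (at (x s))"
      using diff unfolding J_def jacobian_works .
    have adj: "F (x s) \<bullet> (J s *v (transpose (J s) *v F (x s)))
        = (norm (transpose (J s) *v F (x s)))\<^sup>2"
      using dot_lmul_matrix[of "F (x s)" "J s"] transpose_matrix_vector[of "J s" "F (x s)"]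
      by (simp add: power2_norm_eq_inner)
    have "J s *v (h *\<^sub>R ?f) = (- h) *\<^sub>R (J s *v (transpose (J s) *v F (x s)))" for h
      by (metis matrix_vector_mult_scaleR scaleR_minus_left scaleR_minus_right)
    moreover have "((\<lambda>s. F (x s)) has_derivative (\<lambda>h. J s *v (h *\<^sub>R ?f))) (at s within {0..})"
      using x F by (rule has_derivative_compose)
    ultimately have Fx: "((\<lambda>s. F (x s)) has_derivative
        (\<lambda>h. (- h) *\<^sub>R (J s *v (transpose (J s) *v F (x s))))) (at s within {0..})"
      by simp
    show ?thesis
      unfolding g_def has_field_derivative_def power2_norm_eq_inner
      by (rule derivative_eq_intros Fx refl)+
        (use adj in \<open>simp add: fun_eq_iff g'_def inner_commute[of _ "F (x s)"]
          power2_norm_eq_inner[symmetric] algebra_simps\<close>)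
  qed
  have "g t \<le> g 0"
  \<comment> \<open>At time 0 the trajectory has only a one-sided derivative, so two-sided
    derivatives are used in the open interval and continuity at its ends.\<close>
  proof (rule DERIV_nonpos_imp_decreasing_open[OF \<open>t \<ge> 0\<close>])
    fix s :: real assume "0 < s" "s < t"
    then have "at s within {0..} = at s" by (intro at_within_interior) simp
    moreover have "g' s \<le> 0"
      using coercive[of "x s"] by (simp add: g'_def J_def mult_le_0_iff)
    ultimately show "\<exists>y. DERIV g s :> y \<and> y \<le> 0"
      using deriv[of s] \<open>0 < s\<close> by auto
  next
    have "continuous_on {0..} g"
      using deriv by (intro DERIV_continuous_on) auto
    then show "continuous_on {0..t} g" by (rule continuous_on_subset) auto
  qed
  then have "(norm (F (x t)) * exp (\<eta> * t))\<^sup>2 \<le> (norm (F (x 0)))\<^sup>2"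
    by (simp add: g_def power_mult_distrib exp_double[symmetric] mult.assoc)
  then have "norm (F (x t)) * exp (\<eta> * t) \<le> norm (F (x 0))"
    by (rule power2_le_imp_le) simp
  then show ?thesis by (simp add: exp_minus field_simps)
qed

theorem theorem2:
  fixes F :: "real^'m \<Rightarrow> real^'m" and L \<zeta> \<eta> :: real
  assumes "continuously_differentiable F"
    and "L-lipschitz_on UNIV F"
    and "Sol UNIV F \<noteq> {}"
    and "\<zeta> > 0"
    and "\<And>x. \<zeta> * infdist x (Sol UNIV F) \<le> norm (F x)"
    and "dynamical_system (\<lambda>x. - (transpose (jacobian F (at x)) *v F x)) UNIV"
    and "\<eta> > 0"
    and "\<And>x. F x \<noteq> 0 \<Longrightarrow>
           (let A = jacobian F (at x) ** transpose (jacobian F (at x)) in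
              lambda_min A \<ge> \<eta> \<or>
              (lambda_min A = 0 \<and> lambda_2 A \<ge> \<eta> \<and> (\<forall>v\<in>eigenspace A 0. orthogonal (F x) v)))"
  shows "exponentially_stable (\<lambda>x. - (transpose (jacobian F (at x)) *v F x)) UNIV (Sol UNIV F)"
proof -
  let ?f = "\<lambda>x. - (transpose (jacobian F (at x)) *v F x)"
  let ?Z = "Sol UNIV F"
  have "L \<ge> 0" using assms(2) by (rule lipschitz_on_nonneg)
  have diff: "F differentiable (at x)" for x
    using assms(1) by (simp add: continuously_differentiable_def)
  have coercive: "\<eta> * (norm (F x))\<^sup>2 \<le> (norm (transpose (jacobian F (at x)) *v F x))\<^sup>2" for x
  \<comment> \<open>The spectral hypothesis covers only points with \<open>F x \<noteq> 0\<close>;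
    at zeros both sides vanish.\<close>
  proof (cases "F x = 0")
    case False
    let ?J = "jacobian F (at x)"
    let ?A = "?J ** transpose ?J"
    have "transpose ?A = ?A" by (simp add: matrix_transpose_mul)
    then have "\<eta> * (F x \<bullet> F x) \<le> F x \<bullet> (?A *v F x)"
      using assms(8)[OF False] Rayleigh_lambda_min Rayleigh_lambda_2 unfolding Let_def by metis
    also have "\<dots> = (norm (transpose ?J *v F x))\<^sup>2"
      using dot_lmul_matrix[of "F x" ?J] transpose_matrix_vector[of ?J "F x"]
      by (simp add: power2_norm_eq_inner flip: matrix_vector_mul_assoc)
    finally show ?thesis by (simp add: power2_norm_eq_inner)
  qed simp
  note decay = gradient_flow_norm_decay[OF diff coercive]
  have "continuous_on UNIV F" using assms(2) by (rule lipschitz_on_continuous_on)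
  then have "closed ?Z"
    unfolding Sol_UNIV by (intro closed_Collect_eq continuous_on_const)
  moreover have "positively_invariant ?f UNIV ?Z"
    unfolding positively_invariant_def Sol_UNIV using decay by fastforce
  \<comment> \<open>\<open>L + 1\<close> replaces \<open>L\<close> so that the factor is positive
    even if \<open>L = 0\<close>.\<close>
  moreover have "infdist (x t) ?Z \<le> (L + 1) / \<zeta> * infdist (x 0) ?Z * exp (- \<eta> * t)"
    if "solution ?f UNIV x" "t \<ge> 0" for x t
  proof -
    have "norm (F (x 0)) \<le> L * infdist (x 0) ?Z"
      using assms(2,3) by (rule norm_le_lipschitz_infdist) (simp add: Sol_UNIV)
    also have "\<dots> \<le> (L + 1) * infdist (x 0) ?Z"
      by (simp add: mult_right_mono infdist_nonneg)
    finally have "norm (F (x 0)) * exp (- \<eta> * t) \<le> (L + 1) * infdist (x 0) ?Z * exp (- \<eta> * t)"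
      by (simp add: mult_right_mono)
    then have "\<zeta> * infdist (x t) ?Z \<le> (L + 1) * infdist (x 0) ?Z * exp (- \<eta> * t)"
      using assms(5)[of "x t"] decay[OF that] by linarith
    then show ?thesis using \<open>\<zeta> > 0\<close> by (simp add: field_simps)
  qed
  moreover have "(L + 1) / \<zeta> > 0" using \<open>L \<ge> 0\<close> \<open>\<zeta> > 0\<close> by simp
  \<comment> \<open>The estimate holds from every initial point, so radius 1 serves as
    \<open>\<beta>3\<close>; the rate \<open>\<beta>2\<close> is \<open>\<eta>\<close>.\<close>
  ultimately show ?thesis
    unfolding exponentially_stable_def using \<open>\<eta> > 0\<close> zero_less_one by blast
qed

end
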